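(* Let $R$ be a finite group and let $\mathrm{Sub}(R)$ be the family of all subgroups of $R$. Then $$|\mathrm{Sub}(R)|< c(2)\cdot |R|^{\frac{\log_2(|R|)}{4}}.$$
   Context: For a prime number $p$, the constant $c(p)$ is defined by $$c(p):=\prod_{i\ge 1}\frac{1}{1-\frac{1}{p^i}}\cdot\left(-1+2\sum_{k=0}^\infty\frac{1}{p^{k^2}}\right).$$ In particular $c(2)$ is approximately $7.37197$. *)

theory Defs
  imports "HOL-Analysis.Infinite_Products" "HOL-Algebra.Coset"
begin

text \<open>
  The factor of index \<open>i\<close> below is the one for \<open>i + 1\<close> in the product over
  \<open>i \<ge> 1\<close>. The definition is meant for prime \<open>p\<close>; the next two lemmas show
  that the product and the series then converge, so that \<^const>\<open>prodinf\<close> and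
  \<^const>\<open>suminf\<close> denote the actual limits.
\<close>

definition subgroup_const :: "nat \<Rightarrow> real" where
  "subgroup_const p =
     (\<Prod>i. 1 / (1 - 1 / real p ^ Suc i)) * (- 1 + 2 * (\<Sum>k. 1 / real p ^ (k\<^sup>2)))"

lemma subgroup_const_product_converges:
  fixes p :: nat
  assumes "p \<ge> 2"
  shows "convergent_prod (\<lambda>i. 1 / (1 - 1 / real p ^ Suc i))"
proof -
  have "summable (\<lambda>i. (1 / real p) ^ Suc i)"
    using assms by (subst summable_Suc_iff) (auto intro!: summable_geometric)
  then have "summable (\<lambda>i. norm ((1 - 1 / real p ^ Suc i) - 1))"
    by (simp add: power_one_over)
  then have "abs_convergent_prod (\<lambda>i. 1 - 1 / real p ^ Suc i)"
    by (rule summable_imp_abs_convergent_prod)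
  then have "convergent_prod (\<lambda>i. 1 - 1 / real p ^ Suc i)"
    by (rule abs_convergent_prod_imp_convergent_prod)
  then show ?thesis
    using convergent_prod_inverse by (simp add: divide_inverse)
qed

lemma subgroup_const_series_summable:
  fixes p :: nat
  assumes "p \<ge> 2"
  shows "summable (\<lambda>k. 1 / real p ^ (k\<^sup>2))"
proof (rule summable_comparison_test)
  show "summable (\<lambda>k. (1 / real p) ^ k)"
    using assms by (auto intro!: summable_geometric)
  have "1 / real p ^ (k\<^sup>2) \<le> (1 / real p) ^ k" for k
  proof -
    have "k \<le> k\<^sup>2"
      by (simp add: power2_eq_square)
    then have "(1 / real p) ^ (k\<^sup>2) \<le> (1 / real p) ^ k"
      using assms by (intro power_decreasing) auto
    then show ?thesis
      by (simp add: power_one_over)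
  qed
  then show "\<exists>N. \<forall>k\<ge>N. norm (1 / real p ^ (k\<^sup>2)) \<le> (1 / real p) ^ k"
    by auto
qed

end

theory Submission
  imports Defs "HOL-Algebra.Generated_Groups" "HOL-Algebra.Sylow" "HOL-Algebra.Group_Action"
    "HOL-Computational_Algebra.Primes"
begin

text \<open>
  The extremal groups are the elementary abelian 2-groups. In such a group of order
  \<open>n = 2 ^ a\<close> a subgroup of order \<open>2 ^ t\<close> is given by \<open>t\<close> generators, and the number of
  these subgroups is close to \<open>n ^ t / 2 ^ t\<^sup>2\<close> times the product of \<open>1 / (1 - 2 ^ -i)\<close>.
  With \<open>L\<close> the binary logarithm of \<open>n\<close>, the exponent \<open>t * L - t\<^sup>2\<close> equals
  \<open>L\<^sup>2 / 4 - (t - L / 2)\<^sup>2\<close>, so the sum over \<open>t\<close> is \<open>2 powr (L\<^sup>2 / 4)\<close> times a theta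
  series. The constant \<open>subgroup_const 2\<close> is the product of these two factors.

  The same count works as an upper bound in every finite group, without any structure
  theory. Let \<open>t\<close> be the number of prime factors of the order of a subgroup \<open>H\<close>, with
  multiplicity. By Lagrange's theorem, random elements of \<open>H\<close> generate \<open>H\<close> at least as
  quickly as random vectors span the space of dimension \<open>t\<close> over the field with two
  elements (\<open>card_completions_ge\<close>). A \<open>t\<close>-tuple generates only one subgroup, so the
  subgroups whose order has \<open>t\<close> prime factors and is at least \<open>m\<close> number at most
  \<open>growth t * (n / m) ^ t\<close> (\<open>card_subgroups_big_omega_le\<close>). For 2-groups this already
  yields the theorem (\<open>card_subgroups_two_group\<close>).

  If \<open>n = 2 ^ a * m\<close> with \<open>m \<ge> 3\<close> odd, the subgroups are divided into two kinds. A subgroup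
  that is not a 2-group has order at least \<open>3 / 2 * 2 ^ t\<close>; the factor \<open>3 / 2\<close> amounts to
  replacing \<open>n\<close> by \<open>2 * n / 3\<close> in the count above and so saves a factor that grows
  with \<open>n\<close> (\<open>card_mixed_subgroups_le\<close>, \<open>mixed_sum_large\<close>). A 2-subgroup lies in one of
  at most \<open>m\<close> conjugates of a Sylow 2-subgroup, to each of which the bound for 2-groups
  applies (\<open>card_two_subgroups_le\<close>); as \<open>2 powr (L\<^sup>2 / 4)\<close> contains the cross term
  \<open>m powr (a / 2)\<close>, the factor \<open>m\<close> is affordable when \<open>a \<ge> 3\<close> (\<open>sylow_part_le\<close>), and
  when \<open>a \<le> 2\<close> the number of 2-subgroups is at most \<open>2 * n\<close> for trivial reasons. What
  remains is a comparison of numbers, asymptotic for \<open>n \<ge> 32\<close> and by polynomials for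
  smaller \<open>n\<close> (\<open>total_less_large\<close>, \<open>total_less_small\<close>).
\<close>

section \<open>The number of prime factors with multiplicity\<close>

definition big_omega :: "nat \<Rightarrow> nat" where
  "big_omega k = size (prime_factorization k)"

lemma big_omega_1 [simp]: "big_omega 1 = 0" "big_omega (Suc 0) = 0"
  by (simp_all add: big_omega_def)

lemma big_omega_mult: "j > 0 \<Longrightarrow> k > 0 \<Longrightarrow> big_omega (j * k) = big_omega j + big_omega k"
  by (simp add: big_omega_def prime_factorization_mult)

lemma big_omega_prime_power: "prime p \<Longrightarrow> big_omega (p ^ k) = k"
  by (simp add: big_omega_def prime_factorization_prime_power)

lemma big_omega_eq_0_iff: "k > 0 \<Longrightarrow> big_omega k = 0 \<longleftrightarrow> k = 1"
  by (auto simp: big_omega_def prime_factorization_empty_iff)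

lemma two_power_big_omega_le: "k > 0 \<Longrightarrow> 2 ^ big_omega k \<le> k"
proof (induction k rule: prime_divisors_induct)
  case zero
  then show ?case by simp
next
  case (unit k)
  then show ?case by simp
next
  case (factor p k)
  then have "p > 0" "k > 0" "p \<ge> 2" by (auto dest: prime_ge_2_nat prime_gt_0_nat)
  moreover have "big_omega p = 1" using big_omega_prime_power[of p 1] factor by simp
  ultimately show ?case using factor by (auto simp: big_omega_mult intro!: mult_mono)
qed

lemma big_omega_less_of_proper_dvd:
  assumes "j dvd k" "j < k"
  shows "big_omega j < big_omega k"
proof -
  obtain r where r: "k = j * r" using assms by blast
  with assms have "j > 0" "r > 1" by (auto intro: Nat.gr0I Suc_lessI)
  with r show ?thesis using big_omega_eq_0_iff[of r] by (auto simp: big_omega_mult)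
qed

lemma big_omega_dvd_mono: "j dvd k \<Longrightarrow> k > 0 \<Longrightarrow> big_omega j \<le> big_omega k"
  by (auto simp: big_omega_mult elim!: dvdE)

text \<open>
  One odd prime factor contributes at least 3 where a factor 2 would contribute 2.
  This gain of \<open>3 / 2\<close> is what makes subgroups of non-2-power order rare in
  comparison with the subgroups of an elementary abelian 2-group.
\<close>

lemma not_two_power_imp_ge:
  assumes "k > 0" "\<And>i. k \<noteq> 2 ^ i"
  shows "big_omega k > 0" "2 * k \<ge> 3 * 2 ^ big_omega k"
proof -
  obtain p where p: "prime p" "p dvd k" "p \<noteq> 2"
  proof -
    have "k \<noteq> 1" using assms(2)[of 0] by simp
    have "\<exists>p. prime p \<and> p dvd k \<and> p \<noteq> 2"
    proof (rule ccontr)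
      assume "\<not> ?thesis"
      then have "prime_factors k \<subseteq> {2}" by (auto simp: prime_factors_dvd)
      then have "prime_factors k = {} \<or> prime_factors k = {2}" by blast
      then have "k = 2 ^ multiplicity 2 k \<or> k = 2 ^ 0"
        using prime_factorization_nat[OF assms(1)] by auto
      with assms(2) show False by blast
    qed
    then show ?thesis using that by blast
  qed
  obtain r where r: "k = p * r" using p by blast
  have pos: "r > 0" "p > 0" using r assms(1) by (auto intro: Nat.gr0I)
  have "p \<ge> 3" using p prime_ge_2_nat[of p] by simp
  have om: "big_omega k = Suc (big_omega r)"
    using big_omega_prime_power[of p 1] p pos by (simp add: r big_omega_mult)
  then show "big_omega k > 0" by simp
  have "3 * 2 ^ big_omega r \<le> p * r"
    using two_power_big_omega_le[OF pos(1)] \<open>p \<ge> 3\<close> by (intro mult_mono) auto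
  then show "2 * k \<ge> 3 * 2 ^ big_omega k" using om r by simp
qed

section \<open>The probability that random vectors span\<close>

text \<open>
  The probability that \<open>s\<close> independent uniform vectors span the space of dimension
  \<open>e\<close> over the field with two elements: the first vector is 0 with probability
  \<open>1 / 2 ^ e\<close>, and otherwise it leaves a quotient of dimension \<open>e - 1\<close> to be spanned.
  Among the groups whose order has a given number of prime factors, elementary abelian
  2-groups are the hardest to generate, so this serves as a lower bound for all groups.
\<close>

fun gen_prob :: "nat \<Rightarrow> nat \<Rightarrow> real" where
  "gen_prob s 0 = 1"
| "gen_prob 0 (Suc e) = 0"
| "gen_prob (Suc s) (Suc e) =
     (1 / 2 ^ Suc e) * gen_prob s (Suc e) + (1 - 1 / 2 ^ Suc e) * gen_prob s e"

lemma gen_prob_nonneg: "gen_prob s e \<ge> 0"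
proof (induction s e rule: gen_prob.induct)
  case (3 s e)
  have "(1::real) / 2 ^ Suc e \<le> 1" using one_le_power[of "2::real" "Suc e"] by (simp add: field_simps)
  with 3 show ?case unfolding gen_prob.simps by (intro add_nonneg_nonneg mult_nonneg_nonneg) auto
qed auto

lemma gen_prob_Suc_le: "gen_prob s (Suc e) \<le> gen_prob s e"
proof (induction s arbitrary: e)
  case 0
  then show ?case by (cases e) auto
next
  case (Suc s)
  have conv: "x * a + (1 - x) * b \<le> b" if "a \<le> b" "0 \<le> x" for a b x :: real
    using mult_left_mono[OF that] by (simp add: algebra_simps)
  have conv': "a \<le> x * a + (1 - x) * b" if "a \<le> b" "x \<le> 1" for a b x :: real
    using mult_left_mono[of a b "1 - x"] that by (simp add: algebra_simps)
  have "gen_prob (Suc s) (Suc e) \<le> gen_prob s e"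
    using conv[OF Suc.IH[of e], of "1 / 2 ^ Suc e"] by simp
  also have "gen_prob s e \<le> gen_prob (Suc s) e"
  proof (cases e)
    case e: (Suc d)
    have "(1::real) / 2 ^ Suc d \<le> 1" using one_le_power[of "2::real" "Suc d"] by (simp add: field_simps)
    from conv'[OF Suc.IH[of d] this] show ?thesis using e by simp
  qed auto
  finally show ?case .
qed

lemma gen_prob_antimono: "e \<le> e' \<Longrightarrow> gen_prob s e' \<le> gen_prob s e"
  by (rule lift_Suc_antimono_le[of "gen_prob s"]) (rule gen_prob_Suc_le)

lemma gen_prob_eq_0: "s < e \<Longrightarrow> gen_prob s e = 0"
  by (induction s e rule: gen_prob.induct) auto

text \<open>
  The number of \<open>t\<close>-tuples of vectors divided by the number of bases, in dimension
  \<open>t\<close> over the field with two elements.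
\<close>

definition growth :: "nat \<Rightarrow> real" where
  "growth t = (\<Prod>i<t. 1 / (1 - 1 / 2 ^ Suc i))"

lemma gen_prob_diag: "gen_prob t t * growth t = 1"
proof (induction t)
  case 0
  then show ?case by (simp add: growth_def)
next
  case (Suc t)
  have "(1::real) < 2 ^ Suc t" by (rule one_less_power) auto
  then have "(1 - 1 / 2 ^ Suc t :: real) \<noteq> 0" by (simp add: field_simps)
  moreover have "gen_prob (Suc t) (Suc t) = (1 - 1 / 2 ^ Suc t) * gen_prob t t"
    by (simp add: gen_prob_eq_0)
  moreover have "growth (Suc t) = growth t * (1 / (1 - 1 / 2 ^ Suc t))"
    by (simp add: growth_def)
  ultimately show ?case using Suc by simp
qed

lemma growth_nonneg: "0 \<le> growth t"
  using gen_prob_diag[of t] gen_prob_nonneg[of t t] by (smt (verit) mult_nonneg_nonpos)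

section \<open>Counting subgroups by generating tuples\<close>

context group
begin

lemma card_subgroup_dvd:
  assumes "subgroup M G" "subgroup H G" "M \<subseteq> H"
  shows "card M dvd card H"
proof -
  interpret H: group "G\<lparr>carrier := H\<rparr>" using assms by (rule_tac subgroup_imp_group)
  have "subgroup M (G\<lparr>carrier := H\<rparr>)"
    using assms by (metis subgroup_incl)
  from H.lagrange[OF this] have "card H = card (rcosets\<^bsub>G\<lparr>carrier := H\<rparr>\<^esub> M) * card M"
    by (simp add: order_def)
  then show ?thesis by (rule dvdI[OF trans]) (rule mult.commute)
qed

lemma generate_Un_generate:
  assumes "A \<subseteq> carrier G" "B \<subseteq> carrier G"
  shows "generate G (generate G A \<union> B) = generate G (A \<union> B)"
proof
  have "generate G A \<union> B \<subseteq> generate G (A \<union> B)"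
    using mono_generate[of A "A \<union> B"] by (auto intro: generate.incl)
  then show "generate G (generate G A \<union> B) \<subseteq> generate G (A \<union> B)"
    using assms by (intro generate_subgroup_incl generate_is_subgroup) auto
  show "generate G (A \<union> B) \<subseteq> generate G (generate G A \<union> B)"
    by (rule mono_generate) (auto intro: generate.incl)
qed

lemma generate_subgroup_Un:
  assumes "subgroup M G" "B \<subseteq> M"
  shows "generate G (M \<union> B) = M"
  using assms by (metis Un_absorb2 equalityI generate.incl generate_subgroup_incl order_refl subsetI)

abbreviation completions :: "'a set \<Rightarrow> nat \<Rightarrow> 'a set \<Rightarrow> 'a list set" where
  "completions H s M \<equiv> {xs. set xs \<subseteq> H \<and> length xs = s \<and> generate G (M \<union> set xs) = H}"

lemma subgroup_eq_if_big_omega_eq: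
  assumes "subgroup M G" "subgroup H G" "finite H" "M \<subseteq> H" "big_omega (card H) = big_omega (card M)"
  shows "M = H"
proof (rule ccontr)
  assume "M \<noteq> H"
  then have "card M < card H" using assms by (intro psubset_card_mono) auto
  with big_omega_less_of_proper_dvd[OF card_subgroup_dvd[of M H]] assms show False by simp
qed

lemma card_completions_self:
  assumes "subgroup H G" "finite H"
  shows "card (completions H s H) = card H ^ s"
proof -
  have "completions H s H = {xs. set xs \<subseteq> H \<and> length xs = s}"
    using generate_subgroup_Un[OF assms(1)] by (intro Collect_cong) blast
  then show ?thesis using card_lists_length_eq[OF assms(2)] by simp
qed

text \<open>
  Random elements of \<open>H\<close> are added to \<open>M\<close> one at a time. If the index of \<open>M\<close> has
  \<open>e\<close> prime factors, it is at least \<open>2 ^ e\<close>, so an element falls into \<open>M\<close> with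
  probability at most \<open>1 / 2 ^ e\<close>; every other element enlarges \<open>M\<close> to a subgroup
  whose index has fewer prime factors, by Lagrange's theorem. This is the recursion of
  \<open>gen_prob\<close> with inequalities, and \<open>gen_prob\<close> decreases in \<open>e\<close>.
\<close>

lemma card_completions_ge:
  assumes H: "subgroup H G" "finite H"
    and M: "subgroup M G" "M \<subseteq> H"
    and e: "big_omega (card H) = big_omega (card M) + e"
  shows "real (card H) ^ s * gen_prob s e \<le> real (card (completions H s M))"
  using M e
proof (induction s arbitrary: M e)
  case 0
  show ?case
  proof (cases e)
    case zero: 0
    then have "M = H" using 0 H by (intro subgroup_eq_if_big_omega_eq) auto
    with zero show ?thesis using card_completions_self[OF H, of 0] by simp
  qed simp
next
  case (Suc s)
  have Mf: "finite M" using Suc.prems H finite_subset by blast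
  have sub: "H \<subseteq> carrier G" "M \<subseteq> carrier G"
    using H Suc.prems by (auto dest: subgroup.subset)
  have fin: "finite (completions H s N)" for N
    using finite_lists_length_eq[OF H(2), of s] by (rule rev_finite_subset) auto
  show ?case
  proof (cases e)
    case zero: 0
    then have "M = H" using Suc.prems H by (intro subgroup_eq_if_big_omega_eq) auto
    with zero show ?thesis using card_completions_self[OF H, of "Suc s"] by simp
  next
    case (Suc e')
    define N where "N x = generate G (M \<union> {x})" for x
    have N: "subgroup (N x) G" "N x \<subseteq> H" "M \<subseteq> N x" "x \<in> N x" if "x \<in> H" for x
    proof -
      have "M \<union> {x} \<subseteq> H" using that Suc.prems by auto
      then show "subgroup (N x) G" "N x \<subseteq> H" unfolding N_def
        using sub H generate_is_subgroup[of "M \<union> {x}"] generate_subgroup_incl[of "M \<union> {x}" H] by blast+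
      show "M \<subseteq> N x" "x \<in> N x" unfolding N_def by (auto intro: generate.incl)
    qed
    have eq: "completions H (Suc s) M = (\<Union>x\<in>H. (#) x ` completions H s (N x))"
    proof -
      have gen: "generate G (M \<union> set (x # xs)) = generate G (N x \<union> set xs)"
        if "x \<in> H" "set xs \<subseteq> H" for x xs
        unfolding N_def using that sub by (subst generate_Un_generate) auto
      have "ys \<in> completions H (Suc s) M \<longleftrightarrow> (\<exists>x\<in>H. \<exists>xs\<in>completions H s (N x). ys = x # xs)" for ys
      proof
        assume ys: "ys \<in> completions H (Suc s) M"
        then obtain x xs where "ys = x # xs" by (cases ys) auto
        with ys gen[of x xs] show "\<exists>x\<in>H. \<exists>xs\<in>completions H s (N x). ys = x # xs" by simp
      next
        assume "\<exists>x\<in>H. \<exists>xs\<in>completions H s (N x). ys = x # xs"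
        then obtain x xs where "x \<in> H" "xs \<in> completions H s (N x)" "ys = x # xs" by blast
        with gen[of x xs] show "ys \<in> completions H (Suc s) M" by simp
      qed
      then show ?thesis by blast
    qed
    have "card (completions H (Suc s) M) = (\<Sum>x\<in>H. card ((#) x ` completions H s (N x)))"
      unfolding eq using H fin by (intro card_UN_disjoint) auto
    also have "\<dots> = (\<Sum>x\<in>H. card (completions H s (N x)))"
      by (intro sum.cong refl card_image) auto
    finally have card: "card (completions H (Suc s) M) = (\<Sum>x\<in>H. card (completions H s (N x)))" .
    have in_M: "real (card H) ^ s * gen_prob s e \<le> card (completions H s (N x))" if "x \<in> M" for x
    proof -
      have "N x = M" unfolding N_def using that Suc.prems by (intro generate_subgroup_Un) auto
      then show ?thesis using Suc.IH[OF Suc.prems] by simp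
    qed
    have out_M: "real (card H) ^ s * gen_prob s e' \<le> card (completions H s (N x))" if "x \<in> H - M" for x
    proof -
      have Nx: "subgroup (N x) G" "N x \<subseteq> H" "M \<subset> N x"
        using N[of x] that by auto
      have "finite (N x)" using Nx(2) H(2) by (rule finite_subset)
      then have "card M < card (N x)" using Nx(3) by (rule psubset_card_mono)
      moreover have "card M dvd card (N x)"
        using Nx Suc.prems by (intro card_subgroup_dvd) auto
      ultimately have less: "big_omega (card M) < big_omega (card (N x))"
        by (intro big_omega_less_of_proper_dvd)
      have "card (N x) dvd card H" using Nx H by (intro card_subgroup_dvd)
      moreover have "card H > 0" using H that by (auto simp: card_gt_0_iff)
      ultimately have le: "big_omega (card (N x)) \<le> big_omega (card H)"
        by (rule big_omega_dvd_mono)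
      define d where "d = big_omega (card H) - big_omega (card (N x))"
      have "d \<le> e'" using less le Suc.prems \<open>e = Suc e'\<close> by (simp add: d_def)
      have "real (card H) ^ s * gen_prob s e' \<le> real (card H) ^ s * gen_prob s d"
        using gen_prob_antimono[OF \<open>d \<le> e'\<close>] by (intro mult_left_mono) auto
      also have "\<dots> \<le> card (completions H s (N x))"
        using Nx le by (intro Suc.IH) (auto simp: d_def)
      finally show ?thesis .
    qed
    define h m where "h = real (card H)" and "m = real (card M)"
    have hpos: "h > 0" using H subgroup.one_closed[OF H(1)] by (auto simp: h_def card_gt_0_iff)
    have index: "m * 2 ^ e \<le> h"
    proof -
      obtain r where r: "card H = card M * r"
        using card_subgroup_dvd[OF Suc.prems(1) H(1) Suc.prems(2)] by blast
      then have "card M > 0" "r > 0" using hpos by (auto simp: h_def intro: Nat.gr0I)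
      then have "big_omega r = e" using r Suc.prems(3) by (simp add: big_omega_mult)
      then have "2 ^ e \<le> r" using two_power_big_omega_le \<open>r > 0\<close> by blast
      then have "card M * 2 ^ e \<le> card H" using r by simp
      then have "real (card M * 2 ^ e) \<le> real (card H)" by (rule of_nat_mono)
      then show ?thesis by (simp add: h_def m_def)
    qed
    have cH: "card (H - M) = card H - card M" "card M \<le> card H" 
      using Mf Suc.prems H by (auto intro: card_Diff_subset card_mono)
    \<comment> \<open>The weight 1 / 2 ^ e of the worse alternative is replaced by the actual weight m / h.\<close>
    have "h ^ Suc s * gen_prob (Suc s) e =
        h ^ s * (h * gen_prob s e' - (h / 2 ^ e) * (gen_prob s e' - gen_prob s e))"
      using \<open>e = Suc e'\<close> by (simp add: algebra_simps diff_divide_distrib)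
    also have "\<dots> \<le> h ^ s * (h * gen_prob s e' - m * (gen_prob s e' - gen_prob s e))"
      using index hpos gen_prob_antimono[of e' e s] \<open>e = Suc e'\<close>
      by (intro mult_left_mono diff_left_mono mult_right_mono) (auto simp: field_simps)
    also have "\<dots> = m * (h ^ s * gen_prob s e) + (h - m) * (h ^ s * gen_prob s e')"
      by (simp add: algebra_simps)
    also have "\<dots> = (\<Sum>x\<in>M. h ^ s * gen_prob s e) + (\<Sum>x\<in>H - M. h ^ s * gen_prob s e')"
      using cH by (simp add: h_def m_def of_nat_diff)
    also have "\<dots> \<le> (\<Sum>x\<in>M. real (card (completions H s (N x))))
        + (\<Sum>x\<in>H - M. real (card (completions H s (N x))))"
      using in_M out_M by (intro add_mono sum_mono) (auto simp: h_def)
    also have "\<dots> = real (card (completions H (Suc s) M))"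
      using H Suc.prems by (simp add: card sum.subset_diff[of M H] add.commute)
    finally show ?thesis by (simp add: h_def)
  qed
qed

text \<open>
  A tuple generates only one subgroup, so the sets of generating \<open>t\<close>-tuples of distinct
  subgroups are disjoint subsets of the set of all \<open>t\<close>-tuples. The point is that all
  orders with \<open>t\<close> prime factors are handled at once: no sum over the divisors of the
  group order arises.
\<close>

lemma card_subgroups_big_omega_le:
  fixes \<S> :: "'a set set" and m :: real
  assumes fin: "finite (carrier G)"
    and S: "\<And>H. H \<in> \<S> \<Longrightarrow> subgroup H G" "\<And>H. H \<in> \<S> \<Longrightarrow> big_omega (card H) = t"
    and m: "0 < m" "\<And>H. H \<in> \<S> \<Longrightarrow> m \<le> card H"
  shows "real (card \<S>) \<le> growth t * (real (order G) / m) ^ t"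
proof -
  have Sfin: "finite \<S>" 
    using S(1) fin by (intro finite_subset[of \<S> "Pow (carrier G)"]) (auto dest: subgroup.subset)
  have Hfin: "finite H" if "H \<in> \<S>" for H
    using S(1)[OF that] fin finite_subset subgroup.subset by blast
  have "(\<Sum>H\<in>\<S>. m ^ t * gen_prob t t) \<le> (\<Sum>H\<in>\<S>. real (card (completions H t {\<one>})))"
  proof (rule sum_mono)
    fix H assume H: "H \<in> \<S>"
    have "m ^ t * gen_prob t t \<le> real (card H) ^ t * gen_prob t t"
      using m H by (intro mult_right_mono power_mono gen_prob_nonneg) auto
    also have "\<dots> \<le> card (completions H t {\<one>})"
      using S[OF H] Hfin[OF H]
      by (intro card_completions_ge triv_subgroup) (auto dest: subgroup.one_closed)
    finally show "m ^ t * gen_prob t t \<le> card (completions H t {\<one>})" .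
  qed
  also have "\<dots> = real (card (\<Union>H\<in>\<S>. completions H t {\<one>}))"
  proof -
    have "finite (completions H t {\<one>})" if "H \<in> \<S>" for H
      using finite_lists_length_eq[OF Hfin[OF that], of t] by (rule rev_finite_subset) auto
    then show ?thesis using Sfin by (subst card_UN_disjoint) auto
  qed
  also have "\<dots> \<le> real (card {xs. set xs \<subseteq> carrier G \<and> length xs = t})"
    using S(1) fin by (intro of_nat_mono card_mono finite_lists_length_eq) (auto dest: subgroup.subset)
  also have "\<dots> = real (order G) ^ t"
    using card_lists_length_eq[OF fin] by (simp add: order_def)
  finally have le: "real (card \<S>) * m ^ t * gen_prob t t \<le> real (order G) ^ t" by simp
  from mult_right_mono[OF le growth_nonneg[of t]]
  have "real (card \<S>) * m ^ t * (gen_prob t t * growth t) \<le> growth t * real (order G) ^ t"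
    by (simp only: mult_ac)
  then have "real (card \<S>) * m ^ t \<le> growth t * real (order G) ^ t"
    by (simp add: gen_prob_diag)
  then show ?thesis using m(1) by (simp add: field_simps power_divide)
qed

end

section \<open>Subgroups of prime power order and Sylow subgroups\<close>

context group
begin

lemma coset_action:
  assumes "subgroup P G"
  shows "group_action G (rcosets P) (\<lambda>g. \<lambda>U\<in>rcosets P. U #> inv g)"
proof -
  have P: "P \<subseteq> carrier G" using assms by (rule subgroup.subset)
  have sub: "U \<subseteq> carrier G" if "U \<in> rcosets P" for U
    using rcosets_subset_PowG[OF assms] that by blast
  have closed: "U #> g \<in> rcosets P" if "U \<in> rcosets P" "g \<in> carrier G" for U g
    using that P by (auto simp: RCOSETS_def coset_mult_assoc)
  have cancel: "U #> g #> h = U #> (g \<otimes> h)" if "U \<in> rcosets P" "g \<in> carrier G" "h \<in> carrier G" for U g h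
    using sub that by (intro coset_mult_assoc) auto
  have id: "U #> \<one> = U" if "U \<in> rcosets P" for U
    using sub that by (intro coset_mult_one)
  have bij: "(\<lambda>U\<in>rcosets P. U #> inv g) \<in> Bij (rcosets P)" if "g \<in> carrier G" for g
    unfolding Bij_def
  proof (intro IntI CollectI)
    show "bij_betw (\<lambda>U\<in>rcosets P. U #> inv g) (rcosets P) (rcosets P)"
      by (rule bij_betw_byWitness[where f' = "\<lambda>U. U #> g"])
        (use that closed in \<open>auto simp: cancel id\<close>)
  qed auto
  show ?thesis
    unfolding group_action_def
  proof (intro group_hom.intro group_hom_axioms.intro group_BijGroup is_group homI)
    fix g h assume gh: "g \<in> carrier G" "h \<in> carrier G"
    show "(\<lambda>U\<in>rcosets P. U #> inv (g \<otimes> h)) =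
      (\<lambda>U\<in>rcosets P. U #> inv g) \<otimes>\<^bsub>BijGroup (rcosets P)\<^esub> (\<lambda>U\<in>rcosets P. U #> inv h)"
      using bij[OF gh(1)] bij[OF gh(2)] gh closed
      by (auto simp: BijGroup_def compose_def cancel inv_mult_group fun_eq_iff)
  qed (auto simp: BijGroup_def bij)
qed

lemma coset_stabilizer_subgroup:
  assumes "subgroup P G" "U \<in> rcosets P"
  shows "subgroup {x \<in> carrier G. U #> x = U} G"
proof -
  have U: "U \<subseteq> carrier G" using rcosets_subset_PowG[OF assms(1)] assms(2) by blast
  show ?thesis
  proof (rule subgroupI)
    show "{x \<in> carrier G. U #> x = U} \<noteq> {}" using coset_mult_one[OF U] by auto
  next
    fix x assume x: "x \<in> {x \<in> carrier G. U #> x = U}"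
    then have "U #> inv x = U #> (x \<otimes> inv x)"
      using coset_mult_assoc[OF U, of x "inv x"] by auto
    also have "\<dots> = U" using x U by (simp add: coset_mult_one)
    finally show "inv x \<in> {x \<in> carrier G. U #> x = U}" using x by simp
  qed (use U in \<open>auto simp: coset_mult_assoc[symmetric]\<close>)
qed

text \<open>
  The stabilizer of \<open>P #> g\<close> is the conjugate of \<open>P\<close> by \<open>g\<close>.
\<close>

lemma card_coset_stabilizer:
  assumes P: "subgroup P G" and "U \<in> rcosets P"
  shows "card {x \<in> carrier G. U #> x = U} = card P"
proof -
  obtain g where g: "g \<in> carrier G" "U = P #> g" using assms(2) by (auto simp: RCOSETS_def)
  have Psub: "P \<subseteq> carrier G" using P by (rule subgroup.subset)
  have "U #> x = U \<longleftrightarrow> g \<otimes> x \<otimes> inv g \<in> P" if x: "x \<in> carrier G" for x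
  proof
    assume "U #> x = U"
    then have "P #> (g \<otimes> x) = P #> g" using g x Psub by (simp add: coset_mult_assoc)
    then have "P #> (g \<otimes> x \<otimes> inv g) = P" using g x Psub
      by (metis coset_mult_assoc coset_mult_one inv_closed m_closed r_inv)
    then show "g \<otimes> x \<otimes> inv g \<in> P" using rcos_self[OF _ P] g x by auto
  next
    assume "g \<otimes> x \<otimes> inv g \<in> P"
    then have "P #> (g \<otimes> x \<otimes> inv g) #> g = P #> g" using P by (simp add: subgroup.rcos_const is_group)
    then show "U #> x = U" using g x Psub by (simp add: coset_mult_assoc m_assoc)
  qed
  then have eq: "{x \<in> carrier G. U #> x = U} = {x \<in> carrier G. g \<otimes> x \<otimes> inv g \<in> P}" by auto
  have cancel: "inv g \<otimes> (g \<otimes> y) = y" "g \<otimes> (inv g \<otimes> y) = y" if "y \<in> carrier G" for y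
    using g that by (simp_all flip: m_assoc)
  have "bij_betw (\<lambda>x. g \<otimes> x \<otimes> inv g) {x \<in> carrier G. g \<otimes> x \<otimes> inv g \<in> P} P"
    by (rule bij_betw_byWitness[where f' = "\<lambda>x. inv g \<otimes> x \<otimes> g"])
      (use g Psub in \<open>auto simp: m_assoc subset_iff cancel\<close>)
  then show ?thesis unfolding eq by (rule bij_betw_same_card)
qed

text \<open>
  The orbits of \<open>Q\<close> on the cosets of \<open>P\<close> have \<open>p\<close>-power size, and their sizes add up
  to the index of \<open>P\<close>, which is prime to \<open>p\<close>; so some orbit is a single coset. Hence every
  \<open>p\<close>-subgroup lies in a conjugate of the Sylow subgroup \<open>P\<close>, and there are at most
  as many conjugates as cosets.
\<close>

lemma p_subgroup_fixes_coset:
  assumes fin: "finite (carrier G)" and p: "prime p"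
    and P: "subgroup P G" "\<not> p dvd card (rcosets P)"
    and Q: "subgroup Q G" "card Q = p ^ k"
  obtains U where "U \<in> rcosets P" "Q \<subseteq> {x \<in> carrier G. U #> x = U}"
proof -
  let ?\<phi> = "\<lambda>g. \<lambda>U\<in>rcosets P. U #> inv g" and ?Q = "G\<lparr>carrier := Q\<rparr>"
  interpret act: group_action ?Q "rcosets P" ?\<phi>
    by (rule group_action.induced_action[OF coset_action[OF P(1)] Q(1)])
  have finE: "finite (rcosets P)"
    using rcosets_subset_PowG[OF P(1)] fin finite_subset by blast
  have part: "partition (rcosets P) (orbits ?Q (rcosets P) ?\<phi>)" by (rule act.orbit_partition)
  have fin_orb: "finite (orbits ?Q (rcosets P) ?\<phi>)"
    using finE by (simp add: orbits_def)
  have "\<exists>X\<in>orbits ?Q (rcosets P) ?\<phi>. \<not> p dvd card X"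
  proof (rule ccontr)
    assume "\<not> ?thesis"
    then have dvd: "\<forall>X\<in>orbits ?Q (rcosets P) ?\<phi>. p dvd card X" by blast
    have "card (rcosets P) = (\<Sum>X\<in>orbits ?Q (rcosets P) ?\<phi>. card X)"
      using disjoint_sum[OF fin_orb finE part, of "\<lambda>_. 1::nat"] by simp
    with dvd P(2) show False by (metis (no_types, lifting) dvd_sum)
  qed
  then obtain U where U: "U \<in> rcosets P" "\<not> p dvd card (orbit ?Q ?\<phi> U)"
    by (auto simp: orbits_def)
  have "card (orbit ?Q ?\<phi> U) dvd p ^ k"
    using act.orbit_stabilizer_theorem[OF U(1), symmetric] Q by (simp add: order_def)
  then obtain j where "card (orbit ?Q ?\<phi> U) = p ^ j"
    using divides_primepow_nat[OF p] by blast
  with U(2) have "card (orbit ?Q ?\<phi> U) = 1" by (cases j) auto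
  moreover have "U \<in> orbit ?Q ?\<phi> U" by (rule act.orbit_refl[OF U(1)])
  ultimately have orb: "orbit ?Q ?\<phi> U = {U}" by (auto simp: card_1_singleton_iff)
  have "U #> x = U" if "x \<in> Q" for x
  proof -
    have x: "inv x \<in> Q" "x \<in> carrier G" using Q(1) that by (auto simp: subgroup.m_inv_closed subgroup.mem_carrier)
    then have "?\<phi> (inv x) U \<in> orbit ?Q ?\<phi> U"
      unfolding orbit_def by (intro CollectI exI[of _ "inv x"] conjI refl) simp
    with orb U(1) x show ?thesis by simp
  qed
  with U(1) Q(1) show ?thesis by (intro that) (auto dest: subgroup.subset)
qed

end

section \<open>The two factors of the constant\<close>

definition euler_const :: real where
  "euler_const = (\<Prod>i. 1 / (1 - 1 / 2 ^ Suc i))"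

text \<open>
  The sum of \<open>1 / 2 ^ k\<^sup>2\<close> over all integers \<open>k\<close>.
\<close>

definition theta_const :: real where
  "theta_const = - 1 + 2 * (\<Sum>k. 1 / 2 ^ k\<^sup>2)"

lemma subgroup_const_2: "subgroup_const 2 = euler_const * theta_const"
  by (simp add: subgroup_const_def euler_const_def theta_const_def)

lemma growth_le_euler_const: "growth t \<le> euler_const"
proof -
  have conv: "convergent_prod (\<lambda>i. 1 / (1 - 1 / 2 ^ Suc i :: real))"
    using subgroup_const_product_converges[of 2] by simp
  have ge1: "1 \<le> 1 / (1 - 1 / 2 ^ Suc i :: real)" for i
  proof -
    have "(1::real) < 2 ^ Suc i" by (rule one_less_power) auto
    then show ?thesis by (simp add: field_simps)
  qed
  show ?thesis
    unfolding growth_def euler_const_def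
    using convergent_prod_has_prod[OF conv] ge1 order.trans[OF zero_le_one ge1]
    by (intro prod_le_prodinf) auto
qed

lemma euler_const_ge: "17 / 5 \<le> euler_const"
proof -
  have "17 / 5 \<le> growth 6" by (simp add: growth_def numeral_eq_Suc)
  then show ?thesis using growth_le_euler_const[of 6] by linarith
qed

lemma summable_theta: "summable (\<lambda>k. 1 / 2 ^ k\<^sup>2 :: real)"
  using subgroup_const_series_summable[of 2] by simp

lemma sum_le_theta:
  assumes "finite A"
  shows "(\<Sum>k\<in>A. 1 / 2 ^ k\<^sup>2 :: real) \<le> (theta_const + 1) / 2"
  using sum_le_suminf[OF summable_theta assms] by (simp add: theta_const_def)

lemma sum_less_theta: "1 + 2 * (\<Sum>k=1..b. 1 / 2 ^ k\<^sup>2 :: real) < theta_const"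
proof -
  have "(\<Sum>k<Suc b. 1 / 2 ^ k\<^sup>2 :: real) < (\<Sum>k. 1 / 2 ^ k\<^sup>2)"
    by (rule sum_less_suminf[OF summable_theta]) auto
  moreover have "(\<Sum>k<Suc b. 1 / 2 ^ k\<^sup>2 :: real) = 1 + (\<Sum>k=1..b. 1 / 2 ^ k\<^sup>2)"
    by (simp add: sum.atLeast1_atMost_eq sum.lessThan_Suc_shift del: sum.lessThan_Suc)
  ultimately show ?thesis by (simp add: theta_const_def)
qed

lemma theta_const_ge: "2.128936 \<le> theta_const"
proof -
  have "{1..4} = {1, 2, 3, 4::nat}" by auto
  then show ?thesis using sum_less_theta[of 4] by simp
qed

text \<open>
  The bound exceeds the full series by about \<open>10 ^ -9\<close>. This precision is needed:
  the two sides of the inequality in the odd case of \<open>elementary_abelian_sum_less\<close>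
  differ by only a few millionths.
\<close>

lemma sum_pronic_le: "(\<Sum>k\<le>b. 1 / 2 ^ (k * (k + 1)) :: real) \<le> 1.2658700962"
proof -
  \<comment> \<open>The tail is dominated by a geometric series from k = 5 on, as k * (k + 1) \<ge> 25 + k there.\<close>
  have *: "(\<Sum>k\<le>b. 1 / 2 ^ (k * (k + 1)) :: real) \<le> 1.2658700962 - 1 / 2 ^ (25 + b)" if "4 \<le> b" for b
    using that
  proof (induction b rule: dec_induct)
    case base
    show ?case by (simp add: numeral_eq_Suc)
  next
    case (step b)
    have "25 + Suc b \<le> Suc b * (Suc b + 1)"
      using mult_le_mono[of 5 "Suc b" 5 "Suc b"] step by simp
    then have "1 / 2 ^ (Suc b * (Suc b + 1)) \<le> (1 / 2 ^ (25 + Suc b) :: real)"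
      by (intro divide_left_mono power_increasing) auto
    moreover have "1 / 2 ^ (25 + b) = 1 / 2 ^ (25 + Suc b) + (1 / 2 ^ (25 + Suc b) :: real)"
      by (simp only: add_Suc_right power_Suc)
    ultimately show ?case using step.IH unfolding sum.atMost_Suc by linarith
  qed
  have "(\<Sum>k\<le>b. 1 / 2 ^ (k * (k + 1)) :: real) \<le> (\<Sum>k\<le>b + 4. 1 / 2 ^ (k * (k + 1)))"
    by (intro sum_mono2) auto
  also have "\<dots> \<le> 1.2658700962"
    using *[of "b + 4"] by (rule order_trans) auto
  finally show ?thesis .
qed

lemma two_power_quarter_square:
  "(2::real) ^ b\<^sup>2 = 2 powr ((real (2 * b))\<^sup>2 / 4)"
  "(2::real) ^ (b * (b + 1)) * 2 powr (1 / 4) = 2 powr ((real (2 * b + 1))\<^sup>2 / 4)"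
proof -
  have "(real (2 * b))\<^sup>2 / 4 = real (b\<^sup>2)" by (simp add: power2_eq_square)
  then show "(2::real) ^ b\<^sup>2 = 2 powr ((real (2 * b))\<^sup>2 / 4)"
    by (metis powr_realpow zero_less_numeral)
  have "(real (2 * b + 1))\<^sup>2 / 4 = real (b * (b + 1)) + 1 / 4"
    by (simp add: power2_eq_square field_simps)
  then show "(2::real) ^ (b * (b + 1)) * 2 powr (1 / 4) = 2 powr ((real (2 * b + 1))\<^sup>2 / 4)"
    by (metis powr_realpow zero_less_numeral powr_add)
qed

text \<open>
  Completing the square turns the sum into \<open>2 powr (a\<^sup>2 / 4)\<close> times the sum of
  \<open>2 powr (- (t - a / 2)\<^sup>2)\<close>. For even \<open>a\<close> this is a truncation of the series for
  \<open>theta_const\<close>. For odd \<open>a\<close> it is a truncation of the series shifted by \<open>1 / 2\<close>,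
  whose value is smaller by a few millionths.
\<close>

lemma elementary_abelian_sum_less:
  "(\<Sum>t\<le>a. 2 ^ ((a - t) * t) :: real) < theta_const * 2 powr ((real a)\<^sup>2 / 4)"
proof (cases "even a")
  case True
  then obtain b where b: "a = 2 * b" by (elim evenE)
  have "(\<Sum>t\<le>a. 2 ^ ((a - t) * t) :: real) = (\<Sum>t\<le>b. 2 ^ ((a - t) * t)) + (\<Sum>t=b+1..b+b. 2 ^ ((a - t) * t))"
    unfolding b using sum_up_index_split[of "\<lambda>t. 2 ^ ((2 * b - t) * t) :: real" b b] by (simp add: mult_2)
  also have "(\<Sum>t\<le>b. 2 ^ ((a - t) * t) :: real) = (\<Sum>k\<le>b. 2 ^ b\<^sup>2 * (1 / 2 ^ k\<^sup>2))"
  proof (rule sum.reindex_bij_witness[of _ "\<lambda>k. b - k" "\<lambda>t. b - t"])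
    fix t assume "t \<in> {..b}"
    then obtain k where "b = t + k" using le_Suc_ex by auto
    then have "b\<^sup>2 = (a - t) * t + (b - t)\<^sup>2" by (simp add: b power2_eq_square algebra_simps)
    then show "2 ^ b\<^sup>2 * (1 / 2 ^ (b - t)\<^sup>2) = (2 ^ ((a - t) * t) :: real)"
      by (simp add: power_add)
  qed auto
  also have "(\<Sum>t=b+1..b+b. 2 ^ ((a - t) * t) :: real) = (\<Sum>k=1..b. 2 ^ b\<^sup>2 * (1 / 2 ^ k\<^sup>2))"
  proof (rule sum.reindex_bij_witness[of _ "\<lambda>k. b + k" "\<lambda>t. t - b"])
    fix t assume "t \<in> {b+1..b+b}"
    then obtain k j where "t = b + k" "b = k + j" by (metis atLeastAtMost_iff le_Suc_ex add_leD1 add_le_cancel_left)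
    then have "b\<^sup>2 = (a - t) * t + (t - b)\<^sup>2" by (simp add: b power2_eq_square algebra_simps)
    then show "2 ^ b\<^sup>2 * (1 / 2 ^ (t - b)\<^sup>2) = (2 ^ ((a - t) * t) :: real)"
      by (simp add: power_add)
  qed auto
  also have "(\<Sum>k\<le>b. 2 ^ b\<^sup>2 * (1 / 2 ^ k\<^sup>2) :: real) = 2 ^ b\<^sup>2 + (\<Sum>k=1..b. 2 ^ b\<^sup>2 * (1 / 2 ^ k\<^sup>2))"
    by (simp add: sum.atMost_shift sum.atLeast1_atMost_eq)
  finally have "(\<Sum>t\<le>a. 2 ^ ((a - t) * t) :: real) = 2 ^ b\<^sup>2 * (1 + 2 * (\<Sum>k=1..b. 1 / 2 ^ k\<^sup>2))"
    by (simp add: sum_distrib_left algebra_simps)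
  also have "\<dots> < 2 ^ b\<^sup>2 * theta_const"
    using sum_less_theta by (intro mult_strict_left_mono) auto
  finally show ?thesis by (simp add: two_power_quarter_square b mult.commute)
next
  case False
  then obtain b where b: "a = 2 * b + 1" by (elim oddE)
  have "(\<Sum>t\<le>a. 2 ^ ((a - t) * t) :: real) = (\<Sum>t\<le>b. 2 ^ ((a - t) * t)) + (\<Sum>t=b+1..b+(b+1). 2 ^ ((a - t) * t))"
    unfolding b using sum_up_index_split[of "\<lambda>t. 2 ^ ((2 * b + 1 - t) * t) :: real" b "b + 1"] by (simp add: mult_2)
  also have "(\<Sum>t\<le>b. 2 ^ ((a - t) * t) :: real) = (\<Sum>k\<le>b. 2 ^ (b * (b + 1)) * (1 / 2 ^ (k * (k + 1))))"
  proof (rule sum.reindex_bij_witness[of _ "\<lambda>k. b - k" "\<lambda>t. b - t"])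
    fix t assume "t \<in> {..b}"
    then obtain k where "b = t + k" using le_Suc_ex by auto
    then have "b * (b + 1) = (a - t) * t + (b - t) * (b - t + 1)" by (simp add: b algebra_simps)
    then show "2 ^ (b * (b + 1)) * (1 / 2 ^ ((b - t) * (b - t + 1))) = (2 ^ ((a - t) * t) :: real)"
      by (simp add: power_add)
  qed auto
  also have "(\<Sum>t=b+1..b+(b+1). 2 ^ ((a - t) * t) :: real) = (\<Sum>k\<le>b. 2 ^ (b * (b + 1)) * (1 / 2 ^ (k * (k + 1))))"
  proof (rule sum.reindex_bij_witness[of _ "\<lambda>k. b + 1 + k" "\<lambda>t. t - (b + 1)"])
    fix t assume t: "t \<in> {b+1..b+(b+1)}"
    define k j where "k = t - (b + 1)" and "j = 2 * b + 1 - t"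
    have "t = b + 1 + k" "b = k + j" using t by (auto simp: k_def j_def)
    then have "b * (b + 1) = (a - t) * t + (t - (b + 1)) * (t - (b + 1) + 1)"
      by (simp add: b algebra_simps)
    then show "2 ^ (b * (b + 1)) * (1 / 2 ^ ((t - (b + 1)) * (t - (b + 1) + 1))) = (2 ^ ((a - t) * t) :: real)"
      by (simp add: power_add)
  qed auto
  finally have "(\<Sum>t\<le>a. 2 ^ ((a - t) * t) :: real) = 2 ^ (b * (b + 1)) * (2 * (\<Sum>k\<le>b. 1 / 2 ^ (k * (k + 1))))"
    by (simp add: sum_distrib_left algebra_simps)
  also have "\<dots> < 2 ^ (b * (b + 1)) * (theta_const * 2 powr (1 / 4))"
  proof (rule mult_strict_left_mono)
    \<comment> \<open>Twice the bound of sum_pronic_le; fourth powers remove the root of 2.\<close>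
    have "2.5317401924 < theta_const * 2 powr (1 / 4)"
    proof (rule power_less_imp_less_base)
      have "(2.5317401924 :: real) ^ 4 < 2.128936 ^ 4 * 2" by (simp add: power4_eq_xxxx)
      also have "\<dots> \<le> theta_const ^ 4 * 2"
        using theta_const_ge by (intro mult_right_mono power_mono) auto
      also have "\<dots> = (theta_const * 2 powr (1 / 4)) ^ 4"
        by (simp add: power_mult_distrib powr_power)
      finally show "(2.5317401924 :: real) ^ 4 < (theta_const * 2 powr (1 / 4)) ^ 4" .
    qed (use theta_const_ge in auto)
    then show "2 * (\<Sum>k\<le>b. 1 / 2 ^ (k * (k + 1))) < theta_const * 2 powr (1 / 4)"
      using sum_pronic_le[of b] by simp
  qed simp
  finally show ?thesis
    using two_power_quarter_square(2)[of b] by (simp add: b mult.left_commute mult.commute)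
qed

text \<open>
  Splitting the sum at the floor of \<open>s\<close> and moving the centre to the nearest integer on
  each side, each half is at most the sum of \<open>1 / 2 ^ j\<^sup>2\<close> over \<open>j \<ge> 0\<close>, that is
  \<open>(theta_const + 1) / 2\<close>. The sum over all integers \<open>t\<close> is
  \<open>theta_const\<close> for \<open>s = 0\<close>; the loss of 1 is affordable in \<open>mixed_sum_large\<close>.
\<close>

lemma gaussian_sum_le:
  fixes s :: real
  assumes "0 \<le> s"
  shows "(\<Sum>t\<le>T. 2 powr (- (real t - s)\<^sup>2)) \<le> theta_const + 1"
proof -
  define k where "k = nat \<lfloor>s\<rfloor>"
  have k: "real k \<le> s" "s \<le> real (k + 1)" using assms floor_correct[of s] by (simp_all add: k_def add.commute)
  have powr: "2 powr (- (real j)\<^sup>2) = 1 / 2 ^ j\<^sup>2" for j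
    by (simp add: powr_minus_divide flip: powr_realpow)
  have mono: "2 powr (- (real t - s)\<^sup>2) \<le> 1 / 2 ^ j\<^sup>2" if "real j \<le> \<bar>real t - s\<bar>" for t j
  proof -
    have "(real j)\<^sup>2 \<le> (real t - s)\<^sup>2" using that power_mono[of "real j" _ 2] by fastforce
    then show ?thesis by (simp flip: powr)
  qed
  have "(\<Sum>t\<le>T. 2 powr (- (real t - s)\<^sup>2))
      = (\<Sum>t\<in>{..T} \<inter> {..k}. 2 powr (- (real t - s)\<^sup>2)) + (\<Sum>t\<in>{..T} - {..k}. 2 powr (- (real t - s)\<^sup>2))"
    by (rule sum.Int_Diff) simp
  also have "\<dots> \<le> (\<Sum>t\<in>{..T} \<inter> {..k}. 1 / 2 ^ (k - t)\<^sup>2) + (\<Sum>t\<in>{..T} - {..k}. 1 / 2 ^ (t - (k + 1))\<^sup>2)"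
    using k by (intro add_mono sum_mono mono) (auto simp: of_nat_diff)
  also have "(\<Sum>t\<in>{..T} \<inter> {..k}. 1 / 2 ^ (k - t)\<^sup>2 :: real) = (\<Sum>j\<in>(\<lambda>t. k - t) ` ({..T} \<inter> {..k}). 1 / 2 ^ j\<^sup>2)"
    by (subst sum.reindex) (auto simp: inj_on_def)
  also have "(\<Sum>t\<in>{..T} - {..k}. 1 / 2 ^ (t - (k + 1))\<^sup>2 :: real) = (\<Sum>j\<in>(\<lambda>t. t - (k + 1)) ` ({..T} - {..k}). 1 / 2 ^ j\<^sup>2)"
    by (subst sum.reindex) (auto simp: inj_on_def)
  also have "(\<Sum>j\<in>(\<lambda>t. k - t) ` ({..T} \<inter> {..k}). 1 / 2 ^ j\<^sup>2)
      + (\<Sum>j\<in>(\<lambda>t. t - (k + 1)) ` ({..T} - {..k}). 1 / 2 ^ j\<^sup>2) \<le> (theta_const + 1) / 2 + (theta_const + 1) / 2"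
    by (intro add_mono sum_le_theta) auto
  finally show ?thesis by simp
qed


section \<open>The subgroups that are not 2-groups\<close>

lemma two_thirds_le: "2 / 3 \<le> (2 :: real) powr (- 7 / 12)"
proof (rule power_le_imp_le_base)
  show "(2 / 3) ^ Suc 11 \<le> ((2 :: real) powr (- 7 / 12)) ^ Suc 11"
    by (simp add: powr_power powr_minus_divide power_divide)
qed simp

lemma two_powr_four_thirds: "(2 :: real) powr (- 4 / 3) \<le> 2 / 5"
proof (rule power_le_imp_le_base)
  show "((2 :: real) powr (- 4 / 3)) ^ Suc 2 \<le> (2 / 5) ^ Suc 2"
    by (simp add: powr_power powr_minus_divide power_divide)
qed simp

lemma nineteen_twelfths_le_log:
  assumes "3 \<le> (x::real)"
  shows "19 / 12 \<le> log 2 x"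
proof -
  have "(2 :: real) powr (19 / 12) \<le> 3"
  proof (rule power_le_imp_le_base)
    show "((2 :: real) powr (19 / 12)) ^ Suc 11 \<le> 3 ^ Suc 11" by (simp add: powr_power)
  qed simp
  with assms show ?thesis by (subst le_log_iff) auto
qed

text \<open>
  Written as a power of 2, the function of the group order in the theorem can be compared
  with the terms of a theta series by completing the square.
\<close>

definition quarter_power :: "real \<Rightarrow> real" where
  "quarter_power n = 2 powr ((log 2 n)\<^sup>2 / 4)"

lemma quarter_power_eq: "n > 0 \<Longrightarrow> quarter_power n = n powr (log 2 n / 4)"
  by (simp add: quarter_power_def powr_def log_def power2_eq_square)

lemma quarter_power_pos: "0 < quarter_power n"
  by (simp add: quarter_power_def)

text \<open>
  \<open>quarter_power n\<close> is the maximum of \<open>n powr t / 2 powr t\<^sup>2\<close> over real \<open>t\<close>, attained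
  at half of the binary logarithm of \<open>n\<close>. For natural \<open>t\<close> this gives polynomial lower
  bounds.
\<close>

lemma power_le_quarter_power:
  assumes "n > 0"
  shows "n ^ t \<le> 2 ^ t\<^sup>2 * quarter_power n"
proof -
  have "n ^ t = 2 powr (t * log 2 n)"
    using assms by (simp add: powr_realpow[symmetric] powr_def log_def)
  also have "\<dots> \<le> 2 powr (real (t\<^sup>2) + (log 2 n)\<^sup>2 / 4)"
  proof -
    have "0 \<le> (real t - log 2 n / 2)\<^sup>2" by simp
    then show ?thesis by (simp add: power2_eq_square field_simps)
  qed
  also have "\<dots> = 2 ^ t\<^sup>2 * quarter_power n"
    by (simp only: powr_add quarter_power_def powr_realpow zero_less_numeral)
  finally show ?thesis .
qed

text \<open>
  Bounds the number of subgroups whose order is not a power of 2: the term of index \<open>t\<close>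
  comes from the orders with \<open>t\<close> prime factors, which are at least \<open>3 / 2 * 2 ^ t\<close>.
\<close>

definition mixed_sum :: "nat \<Rightarrow> real \<Rightarrow> real" where
  "mixed_sum T n = (\<Sum>t=1..T. growth t * ((2 * n / 3) ^ t / 2 ^ t\<^sup>2))"

text \<open>
  Apart from the factors \<open>growth t\<close>, this is the sum for an elementary abelian group
  with \<open>n\<close> replaced by \<open>2 * n / 3\<close>. That lowers the binary logarithm \<open>L\<close> of \<open>n\<close> by at
  least \<open>7 / 12\<close>, and so \<open>L\<^sup>2 / 4\<close> by at least \<open>4 / 3\<close> once \<open>L \<ge> 5\<close>.
\<close>

lemma mixed_sum_large:
  assumes "n \<ge> 32"
  shows "mixed_sum T n \<le> 2 / 5 * (theta_const + 1) * euler_const * quarter_power n"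
proof -
  define L s where "L = log 2 n" and "s = (L - 7 / 12) / 2"
  have L: "5 \<le> L" "n = 2 powr L"
    using assms by (simp_all add: L_def le_log_iff)
  have summand: "(2 * n / 3) ^ t / 2 ^ t\<^sup>2 \<le> 2 powr s\<^sup>2 * 2 powr (- (real t - s)\<^sup>2)" for t
  proof -
    have "2 * n / 3 \<le> 2 powr (2 * s)"
      using mult_right_mono[OF two_thirds_le, of n] assms
      by (simp add: L(2) s_def diff_divide_distrib flip: powr_add)
    then have "(2 * n / 3) ^ t \<le> (2 powr (2 * s)) ^ t"
      using assms by (intro power_mono) auto
    also have "\<dots> = 2 powr (2 * s * t)"
      by (simp add: powr_powr powr_realpow[symmetric])
    finally have "(2 * n / 3) ^ t / 2 ^ t\<^sup>2 \<le> 2 powr (2 * s * t) / 2 ^ t\<^sup>2"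
      by (intro divide_right_mono) auto
    also have "\<dots> = 2 powr (2 * s * t - real (t\<^sup>2))"
      by (simp only: powr_diff powr_realpow zero_less_numeral)
    also have "\<dots> = 2 powr s\<^sup>2 * 2 powr (- (real t - s)\<^sup>2)"
      by (simp add: power2_eq_square algebra_simps flip: powr_add)
    finally show ?thesis .
  qed
  have "s\<^sup>2 \<le> L\<^sup>2 / 4 + (- 4 / 3)"
    using L by (simp add: s_def power2_eq_square field_simps)
  then have "2 powr s\<^sup>2 \<le> quarter_power n * 2 powr (- 4 / 3)"
    unfolding quarter_power_def L_def[symmetric] powr_add[symmetric] by simp
  also have "\<dots> \<le> quarter_power n * (2 / 5)"
    using quarter_power_pos[of n] by (intro mult_left_mono two_powr_four_thirds) auto
  finally have s: "2 powr s\<^sup>2 \<le> quarter_power n * (2 / 5)" .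
  have "mixed_sum T n \<le> (\<Sum>t=1..T. euler_const * (2 powr s\<^sup>2 * 2 powr (- (real t - s)\<^sup>2)))"
    unfolding mixed_sum_def using assms euler_const_ge
    by (intro sum_mono mult_mono growth_le_euler_const summand) auto
  also have "\<dots> = euler_const * 2 powr s\<^sup>2 * (\<Sum>t=1..T. 2 powr (- (real t - s)\<^sup>2))"
    by (simp add: sum_distrib_left mult.assoc)
  also have "\<dots> \<le> euler_const * (quarter_power n * (2 / 5)) * (theta_const + 1)"
  proof (intro mult_mono s order.refl)
    have "(\<Sum>t=1..T. 2 powr (- (real t - s)\<^sup>2)) \<le> (\<Sum>t\<le>T. 2 powr (- (real t - s)\<^sup>2))"
      by (intro sum_mono2) auto
    also have "\<dots> \<le> theta_const + 1" using L by (intro gaussian_sum_le) (simp add: s_def)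
    finally show "(\<Sum>t=1..T. 2 powr (- (real t - s)\<^sup>2)) \<le> theta_const + 1" .
  qed (use euler_const_ge quarter_power_pos[of n] in \<open>auto intro: sum_nonneg\<close>)
  finally show ?thesis by (simp add: algebra_simps)
qed

lemma mixed_sum_4:
  "mixed_sum 4 n = 2 / 3 * n + 2 / 27 * n ^ 2 + 1 / 567 * n ^ 3 + 1 / 102060 * n ^ 4"
proof -
  have set: "{1..4} = {1, 2, 3, 4::nat}" by auto
  show ?thesis
    by (simp add: mixed_sum_def set growth_def numeral_eq_Suc[of "num.Bit0 num.One"] numeral_3_eq_3 eval_nat_numeral lessThan_Suc)
qed


section \<open>Comparison with the claimed bound\<close>

lemma subgroup_const_2_ge: "36 / 5 \<le> subgroup_const 2"
proof -
  have "36 / 5 \<le> 17 / 5 * (2.128936 :: real)" by simp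
  also have "\<dots> \<le> euler_const * theta_const"
    using euler_const_ge theta_const_ge by (intro mult_mono) auto
  finally show ?thesis by (simp add: subgroup_const_2)
qed

lemma double_le_quarter_power:
  assumes "n \<ge> 32"
  shows "2 * n \<le> quarter_power n"
proof -
  have L: "5 \<le> log 2 n" using assms by (simp add: le_log_iff)
  have "2 * n = 2 powr (1 + log 2 n)" using assms by (simp add: powr_add)
  also have "1 + log 2 n \<le> (log 2 n)\<^sup>2 / 4"
    using mult_nonneg_nonneg[of "log 2 n - 5" "log 2 n + 1"] L by (simp add: power2_eq_square algebra_simps)
  finally show ?thesis by (simp add: quarter_power_def)
qed

text \<open>
  \<open>B\<close> stands for the number of 2-subgroups. The total is at most \<open>2 / 5\<close> of
  \<open>(2 * theta_const + 1) * euler_const * quarter_power n\<close>, and \<open>theta_const > 2\<close>.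
\<close>

lemma total_less_large:
  assumes n: "n \<ge> 32"
    and B: "B \<le> 2 * n \<or> B \<le> 2 / 5 * (subgroup_const 2 * quarter_power n)"
  shows "mixed_sum T n + B < subgroup_const 2 * quarter_power n"
proof -
  let ?f = "quarter_power n"
  have "2 * n \<le> 2 / 5 * (subgroup_const 2 * ?f)"
  proof -
    have "36 / 5 * ?f \<le> subgroup_const 2 * ?f"
      using quarter_power_pos[of n] subgroup_const_2_ge by (intro mult_right_mono) auto
    then show ?thesis using double_le_quarter_power[OF n] quarter_power_pos[of n] by linarith
  qed
  with B have "B \<le> 2 / 5 * (subgroup_const 2 * ?f)" by linarith
  then have B: "B \<le> 2 / 5 * theta_const * euler_const * ?f"
    by (simp add: subgroup_const_2 mult_ac)
  have "mixed_sum T n + B \<le> 2 / 5 * (2 * theta_const + 1) * (euler_const * ?f)"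
    using mixed_sum_large[OF n, of T] B by (simp add: algebra_simps)
  also have "\<dots> < theta_const * (euler_const * ?f)"
    using theta_const_ge euler_const_ge quarter_power_pos[of n] by (intro mult_strict_right_mono) auto
  finally show ?thesis by (simp add: subgroup_const_2 mult_ac)
qed

text \<open>
  For a small order, \<open>36 / 5\<close> times the quadratic lower bound of \<open>quarter_power n\<close>, or
  the linear one if \<open>n < 8\<close>, exceeds the explicit polynomial \<open>mixed_sum 4 n\<close> by a margin that leaves
  room for the number \<open>B\<close> of 2-subgroups. The three alternatives for \<open>B\<close> correspond to
  a Sylow 2-subgroup of order at most 2, equal to 4, and at least 8.
\<close>

lemma total_less_small:
  assumes n: "0 < n" "n < 32"
    and B: "B \<le> n \<or> (B \<le> 2 * n \<and> 12 \<le> n) \<or>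
      (B \<le> 2 / 5 * (subgroup_const 2 * quarter_power n) \<and> 24 \<le> n)"
  shows "mixed_sum 4 n + B < subgroup_const 2 * quarter_power n"
proof -
  define c where "c = subgroup_const 2 * quarter_power n"
  have c: "36 / 5 * quarter_power n \<le> c"
    unfolding c_def using quarter_power_pos[of n] subgroup_const_2_ge by (intro mult_right_mono) auto
  note B = B[folded c_def]
  have "2 / 3 * n + 2 / 27 * n ^ 2 + 1 / 567 * n ^ 3 + 1 / 102060 * n ^ 4 + B < c"
  proof (cases "n < 8")
    case True
    have "n ^ 2 \<le> 8 * n" "n ^ 3 \<le> 64 * n" "n ^ 4 \<le> 512 * n"
      using n True mult_right_mono[OF power_mono[of n 8 1], of n]
        mult_right_mono[OF power_mono[of n 8 2], of n] mult_right_mono[OF power_mono[of n 8 3], of n]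
      by (simp_all add: power2_eq_square power3_eq_cube power4_eq_xxxx mult_ac)
    moreover have "n \<le> 2 * quarter_power n" using power_le_quarter_power[of n 1] n by simp
    ultimately show ?thesis using B c n True by (elim disjE conjE) linarith+
  next
    case False
    have "8 * n \<le> n ^ 2" "n ^ 3 \<le> 32 * n ^ 2" "n ^ 4 \<le> 1024 * n ^ 2"
      using n False mult_right_mono[of n 32 "n ^ 2"] mult_right_mono[OF power_mono[of n 32 2], of "n ^ 2"]
      by (simp_all add: power2_eq_square power3_eq_cube power4_eq_xxxx mult_ac)
    moreover have "n ^ 2 \<le> 16 * quarter_power n" using power_le_quarter_power[of n 2] n by simp
    moreover have "12 \<le> n \<Longrightarrow> 12 * n \<le> n ^ 2" using n by (simp add: power2_eq_square)
    moreover have "0 < n ^ 2" using n by simp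
    ultimately show ?thesis using B c n False by (elim disjE conjE) linarith+
  qed
  then show ?thesis by (simp add: mixed_sum_4 c_def)
qed

text \<open>
  With \<open>l\<close> the binary logarithm of \<open>m\<close>, the exponents differ by
  \<open>(a + l)\<^sup>2 / 4 - a\<^sup>2 / 4 - l = l * (2 * a + l - 4) / 4\<close>, which is at least
  \<open>4 / 3\<close> for \<open>a \<ge> 3\<close> and \<open>l \<ge> 19 / 12\<close>.
\<close>

lemma sylow_part_le:
  assumes "3 \<le> a" "3 \<le> (m::real)"
  shows "m * 2 powr ((real a)\<^sup>2 / 4) \<le> 2 / 5 * quarter_power (2 ^ a * m)"
proof -
  define l where "l = log 2 m"
  have l: "19 / 12 \<le> l" "m = 2 powr l"
    using nineteen_twelfths_le_log[OF assms(2)] assms(2) by (simp_all add: l_def)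
  have L: "log 2 (2 ^ a * m) = a + l" using assms by (simp add: log_mult l_def log_nat_power)
  have "19 / 12 * (43 / 12) \<le> l * (l + 2)" using l by (intro mult_mono) auto
  moreover have "3 * l \<le> a * l" using assms l by (intro mult_right_mono) auto
  ultimately have "l + (real a)\<^sup>2 / 4 \<le> - 4 / 3 + (a + l)\<^sup>2 / 4"
    by (simp add: power2_eq_square field_simps)
  then have "m * 2 powr ((real a)\<^sup>2 / 4) \<le> 2 powr (- 4 / 3) * quarter_power (2 ^ a * m)"
    by (simp add: l(2) quarter_power_def L[unfolded l(2)] flip: powr_add)
  also have "\<dots> \<le> 2 / 5 * quarter_power (2 ^ a * m)"
    using quarter_power_pos by (intro mult_right_mono two_powr_four_thirds less_imp_le)
  finally show ?thesis .
qed

section \<open>Counting 2-subgroups and the other subgroups separately\<close>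

lemma card_le_sum_card:
  assumes "finite I" "\<And>i. i \<in> I \<Longrightarrow> finite (S i)" "A \<subseteq> (\<Union>i\<in>I. S i)"
  shows "real (card A) \<le> (\<Sum>i\<in>I. real (card (S i)))"
proof -
  have "card A \<le> card (\<Union>i\<in>I. S i)" using assms by (intro card_mono) auto
  also have "\<dots> \<le> (\<Sum>i\<in>I. card (S i))" using assms(1) by (rule card_UN_le)
  finally have "real (card A) \<le> real (\<Sum>i\<in>I. card (S i))" by (rule of_nat_mono)
  then show ?thesis by simp
qed

context group
begin

lemma finite_subgroups:
  assumes "finite (carrier G)"
  shows "finite {H. subgroup H G \<and> \<Phi> H}"
  by (rule finite_subset[of _ "Pow (carrier G)"]) (use assms in \<open>auto dest: subgroup.subset\<close>)

lemma card_p_subgroups_le: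
  assumes fin: "finite (carrier G)" and p: "prime p"
    and P: "subgroup P G" "\<not> p dvd card (rcosets P)"
    and B: "\<And>S. subgroup S G \<Longrightarrow> card S = card P \<Longrightarrow> real (card {H. subgroup H G \<and> H \<subseteq> S}) \<le> B"
  shows "real (card {H. subgroup H G \<and> (\<exists>k. card H = p ^ k)}) \<le> real (card (rcosets P)) * B"
proof -
  let ?S = "\<lambda>U. {x \<in> carrier G. U #> x = U}"
  have finE: "finite (rcosets P)"
    using rcosets_subset_PowG[OF P(1)] fin finite_subset by blast
  have fin_sub: "finite {H. subgroup H G \<and> H \<subseteq> S}" for S
    using fin by (rule finite_subgroups)
  have "{H. subgroup H G \<and> (\<exists>k. card H = p ^ k)} \<subseteq> (\<Union>U\<in>rcosets P. {H. subgroup H G \<and> H \<subseteq> ?S U})"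
  proof
    fix H assume H: "H \<in> {H. subgroup H G \<and> (\<exists>k. card H = p ^ k)}"
    then obtain k where "subgroup H G" "card H = p ^ k" by blast
    with p_subgroup_fixes_coset[OF fin p P] obtain U where "U \<in> rcosets P" "H \<subseteq> ?S U" by metis
    with H show "H \<in> (\<Union>U\<in>rcosets P. {H. subgroup H G \<and> H \<subseteq> ?S U})" by blast
  qed
  with finE fin_sub have "real (card {H. subgroup H G \<and> (\<exists>k. card H = p ^ k)})
      \<le> (\<Sum>U\<in>rcosets P. real (card {H. subgroup H G \<and> H \<subseteq> ?S U}))"
    by (rule card_le_sum_card)
  also have "\<dots> \<le> (\<Sum>U\<in>rcosets P. B)"
    using P(1) by (intro sum_mono B coset_stabilizer_subgroup card_coset_stabilizer)
  finally show ?thesis by simp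
qed

lemma subgroups_of_subgroup:
  assumes "subgroup S G"
  shows "{H. subgroup H G \<and> H \<subseteq> S} = {H. subgroup H (G\<lparr>carrier := S\<rparr>)}"
  using assms incl_subgroup[OF assms] subgroup_incl[of _ S] subgroup.subset[of _ "G\<lparr>carrier := S\<rparr>"] by auto

text \<open>
  A subgroup is determined by its nontrivial elements. For groups of order at most 4 this
  beats the asymptotic bound.
\<close>

lemma card_subgroups_le_power:
  assumes fin: "finite (carrier G)"
  shows "card {H. subgroup H G} \<le> 2 ^ (order G - 1)"
proof -
  have "inj_on (\<lambda>H. H - {\<one>}) {H. subgroup H G}"
    by (rule inj_on_inverseI[where g = "insert \<one>"]) (auto dest: subgroup.one_closed)
  moreover have "(\<lambda>H. H - {\<one>}) ` {H. subgroup H G} \<subseteq> Pow (carrier G - {\<one>})"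
    by (auto dest: subgroup.subset)
  ultimately have "card {H. subgroup H G} \<le> card (Pow (carrier G - {\<one>}))"
    using fin by (intro card_inj_on_le) auto
  then show ?thesis using fin by (simp add: card_Pow order_def)
qed

text \<open>
  Summing the tuple count over the orders \<open>2 ^ t\<close> gives the sum for an elementary abelian
  group; the bound \<open>growth t \<le> euler_const\<close> then produces the first factor of the constant
  and \<open>elementary_abelian_sum_less\<close> the second.
\<close>

lemma card_subgroups_two_group:
  assumes order: "order G = 2 ^ a"
  shows "real (card {H. subgroup H G}) < subgroup_const 2 * 2 powr ((real a)\<^sup>2 / 4)"
proof -
  have fin: "finite (carrier G)" using order order_gt_0_iff_finite by simp
  let ?S = "\<lambda>t. {H. subgroup H G \<and> card H = 2 ^ t}"
  have "{H. subgroup H G} \<subseteq> (\<Union>t\<le>a. ?S t)"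
  proof
    fix H assume "H \<in> {H. subgroup H G}"
    then have H: "subgroup H G" by simp
    have "card H dvd order G" unfolding lagrange[OF H, symmetric] by simp
    then have "card H dvd 2 ^ a" using order by simp
    then obtain t where "t \<le> a" "card H = 2 ^ t" using divides_primepow_nat[OF two_is_prime_nat] by blast
    with H show "H \<in> (\<Union>t\<le>a. ?S t)" by blast
  qed
  moreover have "finite (?S t)" for t
    using fin by (rule finite_subgroups)
  ultimately have "real (card {H. subgroup H G}) \<le> (\<Sum>t\<le>a. real (card (?S t)))"
    by (intro card_le_sum_card finite_atMost)
  also have "\<dots> \<le> (\<Sum>t\<le>a. euler_const * 2 ^ ((a - t) * t))"
  proof (rule sum_mono)
    fix t assume "t \<in> {..a}"
    have "real (card (?S t)) \<le> growth t * (real (order G) / 2 ^ t) ^ t"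
      using fin by (intro card_subgroups_big_omega_le) (auto simp: big_omega_prime_power)
    also have "\<dots> = growth t * 2 ^ ((a - t) * t)"
      using \<open>t \<in> {..a}\<close> by (simp add: order power_mult power_diff)
    also have "\<dots> \<le> euler_const * 2 ^ ((a - t) * t)"
      by (intro mult_right_mono growth_le_euler_const) auto
    finally show "real (card (?S t)) \<le> euler_const * 2 ^ ((a - t) * t)" .
  qed
  also have "\<dots> = euler_const * (\<Sum>t\<le>a. 2 ^ ((a - t) * t))" by (simp add: sum_distrib_left)
  also have "\<dots> < euler_const * (theta_const * 2 powr ((real a)\<^sup>2 / 4))"
    using euler_const_ge by (intro mult_strict_left_mono elementary_abelian_sum_less) auto
  finally show ?thesis by (simp add: subgroup_const_2 mult.assoc)
qed

lemma card_mixed_subgroups_le: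
  assumes fin: "finite (carrier G)" and T: "order G < 2 ^ Suc T"
  shows "real (card {H. subgroup H G \<and> (\<nexists>k. card H = 2 ^ k)}) \<le> mixed_sum T (real (order G))"
proof -
  let ?S = "\<lambda>t. {H. subgroup H G \<and> (\<nexists>k. card H = 2 ^ k) \<and> big_omega (card H) = t}"
  have pos: "0 < card H" "card H \<le> order G" if "subgroup H G" for H
    using that fin subgroup.one_closed[OF that] subgroup.subset[OF that] finite_subset[of H]
    by (auto simp: card_gt_0_iff order_def intro: card_mono)
  have "{H. subgroup H G \<and> (\<nexists>k. card H = 2 ^ k)} \<subseteq> (\<Union>t\<in>{1..T}. ?S t)"
  proof
    fix H assume "H \<in> {H. subgroup H G \<and> (\<nexists>k. card H = 2 ^ k)}"
    then have H: "subgroup H G" "\<nexists>k. card H = 2 ^ k" by auto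
    then have "0 < big_omega (card H)" by (intro not_two_power_imp_ge(1) pos) auto
    moreover have "(2::nat) ^ big_omega (card H) < 2 ^ Suc T"
      using two_power_big_omega_le[of "card H"] pos[OF H(1)] T by linarith
    then have "big_omega (card H) < Suc T" by (rule power_less_imp_less_exp[rotated]) simp
    ultimately show "H \<in> (\<Union>t\<in>{1..T}. ?S t)" using H by auto
  qed
  moreover have "finite (?S t)" for t
    using fin by (rule finite_subgroups)
  ultimately have "real (card {H. subgroup H G \<and> (\<nexists>k. card H = 2 ^ k)}) \<le> (\<Sum>t=1..T. real (card (?S t)))"
    by (intro card_le_sum_card finite_atLeastAtMost)
  also have "\<dots> \<le> mixed_sum T (order G)"
    unfolding mixed_sum_def
  proof (rule sum_mono)
    fix t
    have "real (card (?S t)) \<le> growth t * (real (order G) / (3 / 2 * 2 ^ t)) ^ t"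
    proof (rule card_subgroups_big_omega_le[OF fin])
      fix H assume H: "H \<in> ?S t"
      then have "3 * 2 ^ t \<le> 2 * card H" using not_two_power_imp_ge(2)[of "card H"] pos by auto
      then have "real (3 * 2 ^ t) \<le> real (2 * card H)" by (rule of_nat_mono)
      then show "3 / 2 * 2 ^ t \<le> real (card H)" by simp
    qed auto
    also have "real (order G) / (3 / 2 * 2 ^ t) = (2 * real (order G) / 3) / 2 ^ t" by simp
    finally show "real (card (?S t)) \<le> growth t * ((2 * real (order G) / 3) ^ t / 2 ^ t\<^sup>2)"
      by (simp add: power_divide power2_eq_square power_mult)
  qed
  finally show ?thesis .
qed

lemma card_two_subgroups_le:
  assumes fin: "finite (carrier G)" and order: "order G = 2 ^ a * m" "odd m"
    and B: "\<And>S. subgroup S G \<Longrightarrow> card S = 2 ^ a \<Longrightarrow> real (card {H. subgroup H (G\<lparr>carrier := S\<rparr>)}) \<le> B"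
  shows "real (card {H. subgroup H G \<and> (\<exists>k. card H = 2 ^ k)}) \<le> real m * B"
proof -
  obtain P where P: "subgroup P G" "card P = 2 ^ a"
    using sylow_thm[OF two_is_prime_nat is_group order(1) fin] by blast
  then have "card (rcosets P) = m" using lagrange[OF P(1)] order by simp
  with card_p_subgroups_le[OF fin two_is_prime_nat P(1), of B] P B order(2) subgroups_of_subgroup
  show ?thesis by simp
qed

end

section \<open>The bound for arbitrary finite groups\<close>

theorem theorem1p1:
  fixes R :: "('a, 'b) monoid_scheme"
  assumes "group R" and "finite (carrier R)"
  shows "real (card {H. subgroup H R})
    < subgroup_const 2 * real (order R) powr (log 2 (real (order R)) / 4)"
proof -
  interpret R: group R by (rule assms(1))
  note fin = assms(2)
  define n where "n = real (order R)"
  have pos: "0 < order R" using fin R.order_gt_0_iff_finite by blast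
  then have npos: "0 < n" by (simp add: n_def)
  obtain a m where m: "order R = 2 ^ a * m" "odd m"
  proof (rule multiplicity_decompose'[of "order R" "2::nat"])
    fix m assume "order R = 2 ^ multiplicity 2 (order R) * m" "odd m"
    then show thesis by (rule that)
  qed (use pos in auto)
  have "real (card {H. subgroup H R}) < subgroup_const 2 * quarter_power n"
  proof (cases "m = 1")
    case True
    then have "log 2 n = a" using m by (simp add: n_def log_nat_power)
    with True m R.card_subgroups_two_group[of a] show ?thesis by (simp add: quarter_power_def)
  next
    case False
    with m(2) have m3: "3 \<le> m" by (cases m rule: nat.exhaust) (auto elim!: oddE)
    have n: "n = 2 ^ a * real m" using m by (simp add: n_def)
    have "2 ^ a * 3 \<le> 2 ^ a * real m" using m3 by simp
    then have n_ge: "2 ^ a * 3 \<le> n" by (simp add: n)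
    define B where "B = real (card {H. subgroup H R \<and> (\<exists>k. card H = 2 ^ k)})"
    have grp: "group (R\<lparr>carrier := S\<rparr>)" "order (R\<lparr>carrier := S\<rparr>) = card S" if "subgroup S R" for S
      using that by (auto simp: order_def R.subgroup_imp_group)
    have B_small: "B \<le> real m * 2 ^ (2 ^ a - 1)"
      unfolding B_def
    proof (rule R.card_two_subgroups_le[OF fin m])
      fix S assume S: "subgroup S R" "card S = 2 ^ a"
      then have "finite S" by (simp add: card_ge_0_finite)
      then have "card {H. subgroup H (R\<lparr>carrier := S\<rparr>)} \<le> 2 ^ (2 ^ a - 1)"
        using group.card_subgroups_le_power[OF grp(1)[OF S(1)]] grp(2)[OF S(1)] S by simp
      then show "real (card {H. subgroup H (R\<lparr>carrier := S\<rparr>)}) \<le> 2 ^ (2 ^ a - 1)"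
        using of_nat_mono by fastforce
    qed
    have B_large: "B \<le> real m * (subgroup_const 2 * 2 powr ((real a)\<^sup>2 / 4))"
      unfolding B_def
    proof (rule R.card_two_subgroups_le[OF fin m])
      fix S assume S: "subgroup S R" "card S = 2 ^ a"
      then show "real (card {H. subgroup H (R\<lparr>carrier := S\<rparr>)}) \<le> subgroup_const 2 * 2 powr ((real a)\<^sup>2 / 4)"
        using group.card_subgroups_two_group[OF grp(1)[OF S(1)], of a] grp(2)[OF S(1)] by simp
    qed
    \<comment> \<open>For a Sylow 2-subgroup of order 1, 2 or 4 the trivial bounds 1, 2 and 8 on its number of subgroups are used.\<close>
    have B: "B \<le> n \<or> (B \<le> 2 * n \<and> 12 \<le> n) \<or> (B \<le> 2 / 5 * (subgroup_const 2 * quarter_power n) \<and> 24 \<le> n)"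
    proof (cases "a \<le> 2")
      case True
      then consider "a = 0" | "a = 1" | "a = 2" by linarith
      then show ?thesis using B_small n n_ge by cases auto
    next
      case False
      then have "real m * 2 powr ((real a)\<^sup>2 / 4) \<le> 2 / 5 * quarter_power n"
        using sylow_part_le[of a "real m"] m3 by (simp add: n)
      then have "subgroup_const 2 * (real m * 2 powr ((real a)\<^sup>2 / 4)) \<le> subgroup_const 2 * (2 / 5 * quarter_power n)"
        using subgroup_const_2_ge by (intro mult_left_mono) auto
      with B_large have "B \<le> 2 / 5 * (subgroup_const 2 * quarter_power n)" by (simp add: mult_ac)
      moreover have "(2::real) ^ 3 \<le> 2 ^ a" using False by (intro power_increasing) auto
      ultimately show ?thesis using n_ge by simp
    qed
    let ?M = "{H. subgroup H R \<and> (\<nexists>k. card H = 2 ^ k)}"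
    have "{H. subgroup H R} = {H. subgroup H R \<and> (\<exists>k. card H = 2 ^ k)} \<union> ?M" by blast
    then have split: "real (card {H. subgroup H R}) \<le> real (card ?M) + B"
      unfolding B_def by (metis (no_types, lifting) add.commute card_Un_le of_nat_add of_nat_mono)
    show ?thesis
    \<comment> \<open>Below 32 a subgroup order has at most 4 prime factors, which makes the sum an explicit polynomial.\<close>
    proof (cases "n < 32")
      case True
      then have "order R < 2 ^ Suc 4" by (simp add: n_def)
      from R.card_mixed_subgroups_le[OF fin this] split total_less_small[OF npos True B]
      show ?thesis by (simp add: n_def)
    next
      case False
      have "order R < 2 ^ Suc (order R)"
        by (rule less_trans[OF less_exp]) simp
      from R.card_mixed_subgroups_le[OF fin this] split total_less_large[of n B "order R"] False B npos
      show ?thesis by (auto simp: n_def)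
    qed
  qed
  then show ?thesis using quarter_power_eq[OF npos] by (simp only: n_def)
qed

end
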